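(* Let $\mathfrak{g}$ be a finite-dimensional complex Lie algebra and let $\mathfrak{p}$ be a perfect Lie subalgebra of $\mathfrak{g}$ (i.e. $[\mathfrak{p},\mathfrak{p}]=\mathfrak{p}$). Then every CPA-structure on $\mathfrak{g}$ satisfies $\mathfrak{p}\cdot\mathfrak{g}=0$, i.e. $x\cdot y=0$ for all $x\in\mathfrak{p}$, $y\in\mathfrak{g}$.
   Context: A CPA-structure on a Lie algebra $\mathfrak{g}$ with bracket $[\,,]$ is a bilinear product $x\cdot y$ on $\mathfrak{g}$ satisfying, for all $x,y,z$: $x\cdot y=y\cdot x$; $[x,y]\cdot z=x\cdot(y\cdot z)-y\cdot(x\cdot z)$; $x\cdot[y,z]=[x\cdot y,z]+[y,x\cdot z]$. *)

theory Defs
  imports Complex_Main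
begin

definition lie_algebra :: "('k::field \<Rightarrow> 'a::ab_group_add \<Rightarrow> 'a) \<Rightarrow> ('a \<Rightarrow> 'a \<Rightarrow> 'a) \<Rightarrow> bool" where
  "lie_algebra sc br \<longleftrightarrow>
     vector_space sc \<and>
     (\<forall>x. Vector_Spaces.linear sc sc (br x)) \<and>
     (\<forall>y. Vector_Spaces.linear sc sc (\<lambda>x. br x y)) \<and>
     (\<forall>x. br x x = 0) \<and>
     (\<forall>x y z. br x (br y z) + br y (br z x) + br z (br x y) = 0)"

definition finite_dim :: "('k::field \<Rightarrow> 'a::ab_group_add \<Rightarrow> 'a) \<Rightarrow> bool" where
  "finite_dim sc \<longleftrightarrow> (\<exists>B. finite_dimensional_vector_space sc B)"

definition lie_subalgebra :: "('k::field \<Rightarrow> 'a::ab_group_add \<Rightarrow> 'a) \<Rightarrow> ('a \<Rightarrow> 'a \<Rightarrow> 'a) \<Rightarrow> 'a set \<Rightarrow> bool" where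
  "lie_subalgebra sc br P \<longleftrightarrow> module.subspace sc P \<and> (\<forall>x\<in>P. \<forall>y\<in>P. br x y \<in> P)"

definition perfect :: "('k::field \<Rightarrow> 'a::ab_group_add \<Rightarrow> 'a) \<Rightarrow> ('a \<Rightarrow> 'a \<Rightarrow> 'a) \<Rightarrow> 'a set \<Rightarrow> bool" where
  "perfect sc br P \<longleftrightarrow> module.span sc {br x y | x y. x \<in> P \<and> y \<in> P} = P"

definition cpa_structure :: "('k::field \<Rightarrow> 'a::ab_group_add \<Rightarrow> 'a) \<Rightarrow> ('a \<Rightarrow> 'a \<Rightarrow> 'a) \<Rightarrow> ('a \<Rightarrow> 'a \<Rightarrow> 'a) \<Rightarrow> bool" where
  "cpa_structure sc br m \<longleftrightarrow>
     (\<forall>x. Vector_Spaces.linear sc sc (m x)) \<and>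
     (\<forall>y. Vector_Spaces.linear sc sc (\<lambda>x. m x y)) \<and>
     (\<forall>x y. m x y = m y x) \<and>
     (\<forall>x y z. m (br x y) z = m x (m y z) - m y (m x z)) \<and>
     (\<forall>x y z. m x (br y z) = br (m x y) z + br y (m x z))"

end

theory Submission
  imports Defs
begin

text \<open>
  Write \<open>L x\<close> for multiplication by \<open>x\<close> and put \<open>T x = ad x - L x\<close>. Commutativity, applied to both sides
  of the second CPA axiom, makes every \<open>T x\<close> self-adjoint for the product: \<open>T x y \<cdot> z = y \<cdot> T x z\<close>. The
  commutator of \<open>T x\<close> and \<open>T w\<close> is therefore skew-adjoint, and it equals \<open>ad u + L u\<close> with
  \<open>u = [x, w]\<close>. Subtracting the self-adjointness of \<open>ad u - L u\<close> gives \<open>2 (y \<cdot> (u \<cdot> z)) = -2 ([u, y] \<cdot> z)\<close>,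
  that is, \<open>u \<cdot> (y \<cdot> z) = 0\<close>. So \<open>L u L y = 0\<close> for \<open>u\<close> in the derived algebra, and
  \<open>L [u, v] = L u L v - L v L u\<close> vanishes if \<open>u\<close> and \<open>v\<close> both lie there.
\<close>

locale cpa = vector_space sc
  for sc :: "'k::field \<Rightarrow> 'a::ab_group_add \<Rightarrow> 'a" +
  fixes br :: "'a \<Rightarrow> 'a \<Rightarrow> 'a"
    and m :: "'a \<Rightarrow> 'a \<Rightarrow> 'a"
  assumes lie: "lie_algebra sc br"
    and cpa: "cpa_structure sc br m"
begin

lemma module_hom_br: "module_hom sc sc (br x)" "module_hom sc sc (\<lambda>x. br x y)"
  and jacobi: "br x (br y z) + br y (br z x) + br z (br x y) = 0"
  using lie by (simp_all add: lie_algebra_def Vector_Spaces.linear_iff_module_hom)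

lemma br_self: "br x x = 0"
  using lie by (simp add: lie_algebra_def)

lemma module_hom_m: "module_hom sc sc (m x)" "module_hom sc sc (\<lambda>x. m x y)"
  and m_commute: "m x y = m y x"
  and m_br_left: "m (br x y) z = m x (m y z) - m y (m x z)"
  and m_br_right: "m x (br y z) = br (m x y) z + br y (m x z)"
  using cpa unfolding cpa_structure_def Vector_Spaces.linear_iff_module_hom by blast+

lemmas br_linear_simps =
  module_hom.add[OF module_hom_br(1)]
  module_hom.add[OF module_hom_br(2)]
  module_hom.diff[OF module_hom_br(1)]
  module_hom.diff[OF module_hom_br(2)]
  module_hom.neg[OF module_hom_br(1)]
  module_hom.neg[OF module_hom_br(2)]

lemmas m_linear_simps =
  module_hom.add[OF module_hom_m(1)]
  module_hom.add[OF module_hom_m(2)]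
  module_hom.diff[OF module_hom_m(1)]
  module_hom.diff[OF module_hom_m(2)]

lemma m_zero_left: "m 0 y = 0"
  using module_hom.zero[OF module_hom_m(2)] .

lemma m_scale_left: "m (sc c x) y = sc c (m x y)"
  using module_hom.scale[OF module_hom_m(2)] .

lemma br_anticommute: "br y x = - br x y"
proof -
  have "br x y + br y x = br (x + y) (x + y)"
    unfolding br_linear_simps by (simp add: br_self)
  then show ?thesis
    by (simp add: br_self eq_neg_iff_add_eq_0 add.commute)
qed

lemma br_br: "br (br x y) z = br x (br y z) - br y (br x z)"
  using jacobi[of x y z] br_anticommute[of z x] br_anticommute[of z "br x y"]
  by (simp add: br_linear_simps algebra_simps)

definition T :: "'a \<Rightarrow> 'a \<Rightarrow> 'a" where
  "T x y = br x y - m x y"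

lemma T_self_adjoint: "m (T x y) z = m y (T x z)"
proof -
  \<comment> \<open>Both sides equal \<open>m x (m y z)\<close>.\<close>
  have "m (br x y) z + m y (m x z) = m (br x z) y + m z (m x y)"
    using m_commute[of y z] by (simp add: m_br_left)
  then show ?thesis
    using m_commute[of "br x z" y] m_commute[of "m x y" z]
    by (simp add: T_def m_linear_simps algebra_simps)
qed

text \<open>By the third CPA axiom the mixed commutators \<open>[ad x, L w]\<close> and
  \<open>[L x, ad w]\<close> are \<open>- ad (m w x)\<close> and \<open>ad (m x w)\<close>, so they
  cancel.\<close>

lemma T_commutator: "T x (T w z) - T w (T x z) = br (br x w) z + m (br x w) z"
  using m_commute[of x w]
  by (simp add: T_def br_br m_br_left m_br_right br_linear_simps m_linear_simps algebra_simps)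

text \<open>Moving \<open>T x\<close> and \<open>T w\<close> across the product reverses their
  order, which flips the sign of their commutator.\<close>

lemma commutator_skew_adjoint:
  fixes x w
  defines "u \<equiv> br x w"
  shows "m y (br u z + m u z) = - m (br u y + m u y) z"
  by (simp add: u_def T_commutator[symmetric] m_linear_simps T_self_adjoint)

lemma m_br_m_eq_0:
  assumes "(2::'k) \<noteq> 0"
  shows "m (br x w) (m y z) = 0"
proof -
  define u where "u = br x w"
  have skew: "m y (br u z) + m y (m u z) = - (m (br u y) z + m (m u y) z)"
    using commutator_skew_adjoint[of y x w z] by (simp only: u_def m_linear_simps)
  have self: "m y (br u z) - m y (m u z) = m (br u y) z - m (m u y) z"
    using T_self_adjoint[of u y z] by (simp add: T_def m_linear_simps)
  have "m y (m u z) + m y (m u z) + (m (br u y) z + m (br u y) z)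
      = (m y (br u z) + m y (m u z) + (m (br u y) z + m (m u y) z))
        - (m y (br u z) - m y (m u z) - (m (br u y) z - m (m u y) z))"
    by simp
  also have "\<dots> = 0"
    unfolding skew self by simp
  \<comment> \<open>The second CPA axiom turns \<open>m y (m u z) + m (br u y) z\<close> into
    \<open>m u (m y z)\<close>.\<close>
  finally have "m u (m y z) + m u (m y z) = 0"
    by (simp add: m_br_left)
  then have "sc 2 (m u (m y z)) = 0"
    using scale_left_distrib[of 1 1 "m u (m y z)"] by simp
  then show ?thesis
    using assms by (simp add: u_def)
qed

theorem perfect_m_eq_0:
  assumes two: "(2::'k) \<noteq> 0" and perfect: "perfect sc br P" and "x \<in> P"
  shows "m x y = 0"
proof -
  have P: "P = span {br x y | x y. x \<in> P \<and> y \<in> P}"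
    using perfect by (simp add: perfect_def)
  have ann: "m v (m y z) = 0" if "v \<in> P" for v y z
  proof -
    have "v \<in> span {br x y | x y. x \<in> P \<and> y \<in> P}"
      using that P by simp
    then show ?thesis
    proof (induction rule: span_induct)
      case base
      show "subspace {v. m v (m y z) = 0}"
        by (auto simp: subspace_def m_zero_left m_linear_simps m_scale_left)
    qed (auto simp: m_br_m_eq_0[OF two])
  qed
  \<comment> \<open>Second use of perfectness: on a bracket of \<open>a, b \<in> P\<close>,
    \<open>ann\<close> kills both \<open>L a L b\<close> and \<open>L b L a\<close>.\<close>
  have "x \<in> span {br x y | x y. x \<in> P \<and> y \<in> P}"
    using \<open>x \<in> P\<close> P by simp
  then show ?thesis
  proof (induction rule: span_induct)
    case base
    show "subspace {x. m x y = 0}"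
      by (auto simp: subspace_def m_zero_left m_linear_simps m_scale_left)
  qed (auto simp: m_br_left ann)
qed

end

theorem theorem3p4:
  fixes sc :: "complex \<Rightarrow> 'a::ab_group_add \<Rightarrow> 'a"
    and br :: "'a \<Rightarrow> 'a \<Rightarrow> 'a"
    and P :: "'a set"
    and m :: "'a \<Rightarrow> 'a \<Rightarrow> 'a"
  assumes "lie_algebra sc br"
    and "finite_dim sc"
    and "lie_subalgebra sc br P"
    and "perfect sc br P"
    and "cpa_structure sc br m"
  shows "\<forall>x\<in>P. \<forall>y. m x y = 0"
proof -
  have "vector_space sc"
    using assms(1) by (simp add: lie_algebra_def)
  then interpret cpa sc br m
    using assms(1,5) by (intro cpa.intro cpa_axioms.intro)
  show ?thesis
    using perfect_m_eq_0[OF _ assms(4)] by simp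
qed

end
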